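(* Let $p$ and $t_1$ be positive integers with $p/2 < t_1 < p$, let $\mathcal{P} = PG(p-1,2)$, and let $S_1$ be a $(t_1-1)$-dimensional projective subspace of $\mathcal{P}$. Put $m = 2^{t_1}+1$. Then for every choice of integers $t_2,\ldots,t_m$ with $1 \le t_i \le p - t_1$ for $2 \le i \le m$, there exist projective subspaces $S_2,\ldots,S_m$ of $\mathcal{P}$ such that $S_i$ is $(t_i-1)$-dimensional, i.e. $|S_i| = 2^{t_i}-1$, for each $2\le i\le m$, and $S_i \cap S_j = \emptyset$ for all $i,j \in \{1,\ldots,m\}$ with $i \neq j$.
   Context: $PG(p-1,2)$ denotes the $(p-1)$-dimensional projective geometry over $GF(2)$; its set of points is identified with the set of nonzero vectors of $GF(2)^p$, so it has $2^p-1$ points. A $(t-1)$-dimensional projective subspace of $PG(p-1,2)$ is the set of nonzero vectors of a $t$-dimensional linear subspace of $GF(2)^p$; it has $2^t-1$ points. Intersections and cardinalities refer to these sets of points (the zero vector is never included). *)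

theory Defs
  imports "HOL-Analysis.Cartesian_Space" "HOL-Library.Z2"
begin

text \<open>
  The points of the projective geometry $PG(p-1,2)$ are the nonzero vectors of
  \<^typ>\<open>bit ^ 'n\<close>, where $p$ is the cardinality of \<^typ>\<open>'n\<close>. The projective dimension
  is an integer, so that a linear subspace of dimension $t$ has projective
  dimension $t - 1$ also for $t = 0$.
\<close>

definition projective_subspace :: "int \<Rightarrow> (bit ^ 'n::finite) set \<Rightarrow> bool" where
  "projective_subspace k S \<longleftrightarrow>
     (\<exists>V. vec.subspace V \<and> int (vec.dim V) = k + 1 \<and> S = V - {0})"

end

theory Submission
  imports Defs "HOL-Algebra.Algebraic_Closure_Type"
begin

text \<open>
  Write \<open>GF(2)\<^sup>p = V \<oplus> W\<close> with \<open>V\<close> the subspace of \<open>S\<^sub>1\<close>, identify \<open>V\<close> with the field \<open>K\<close> of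
  order \<open>2 ^ t\<^sub>1\<close> by a linear isomorphism \<open>g : K \<rightarrow> V\<close>, and embed \<open>W\<close> into \<open>K\<close> by a linear map \<open>h\<close>,
  which is possible since \<open>p - t\<^sub>1 \<le> t\<^sub>1\<close>. The graphs \<open>{w + g (a * h w) | w \<in> W}\<close> for the
  \<open>2 ^ t\<^sub>1\<close> elements \<open>a\<close> of \<open>K\<close> meet \<open>V\<close> and each other only in \<open>0\<close>, because \<open>K\<close> has no zero
  divisors. Take \<open>S\<^sub>i\<close> inside the \<open>i\<close>-th graph.
\<close>

text \<open>Coordinates with respect to \<open>B\<close> biject coefficient functions with vectors
  of the span; taking them extensional on \<open>B\<close> makes them unique and countable.\<close>

lemma (in vector_space) card_span_independent:
  assumes "finite B" "independent B"
  shows "card (span B) = CARD('a) ^ card B"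
proof -
  let ?f = "\<lambda>u. \<Sum>v\<in>B. u v *s v"
  have "inj_on ?f (B \<rightarrow>\<^sub>E UNIV)"
  proof (rule inj_onI)
    fix u w assume u: "u \<in> B \<rightarrow>\<^sub>E UNIV" and w: "w \<in> B \<rightarrow>\<^sub>E UNIV" and "?f u = ?f w"
    then have "(\<Sum>v\<in>B. (u v - w v) *s v) = 0"
      by (simp add: scale_left_diff_distrib sum_subtractf)
    then have "\<And>v. v \<in> B \<Longrightarrow> u v - w v = 0"
      using independentD[OF assms(2,1), of "\<lambda>v. u v - w v"] by blast
    then show "u = w"
      using PiE_ext[OF u w] by simp
  qed
  moreover have "?f ` (B \<rightarrow>\<^sub>E UNIV) = span B"
  proof -
    \<comment> \<open>Values of \<open>u\<close> outside \<open>B\<close> do not enter the sum, so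
      restricting to \<open>B\<close> loses nothing.\<close>
    have "?f u \<in> ?f ` (B \<rightarrow>\<^sub>E UNIV)" for u
      by (rule image_eqI[of _ _ "restrict u B"]) auto
    then show ?thesis
      by (auto simp: span_finite[OF assms(1)])
  qed
  ultimately have "card (span B) = card (B \<rightarrow>\<^sub>E (UNIV :: 'a set))"
    using card_image[of ?f "B \<rightarrow>\<^sub>E UNIV"] by simp
  then show ?thesis
    using assms(1) by (simp add: card_PiE)
qed

lemma (in finite_dimensional_vector_space) card_subspace:
  assumes "subspace V"
  shows "card V = CARD('a) ^ dim V"
proof -
  obtain B where B: "B \<subseteq> V" "independent B" "V \<subseteq> span B" "card B = dim V"
    using basis_exists by blast
  then have "span B = V"
    using span_subspace assms by blast
  with B card_span_independent[OF finiteI_independent[OF B(2)] B(2)] show ?thesis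
    by simp
qed

text \<open>Since \<open>q = 0\<close> in the field, \<open>X ^ q - X\<close> has derivative \<open>-1\<close> and hence only simple roots.\<close>

lemma card_Frobenius_fixed_points:
  assumes "prime CHAR('a :: alg_closed_field)" "n > 0"
  defines "q \<equiv> CHAR('a) ^ n"
  shows "card {x::'a. x ^ q = x} = q"
proof -
  define P :: "'a poly" where "P = monom 1 q - monom 1 1"
  have q: "q > 1"
    unfolding q_def using assms(1,2) by (intro one_less_power) (auto dest: prime_gt_1_nat)
  have "of_nat q = (0::'a)"
    using assms(2) by (simp add: q_def)
  then have P': "pderiv P = [:-1:]"
    by (simp add: P_def pderiv_diff pderiv_monom monom_0)
  have deg: "degree P = q"
    using q degree_add_eq_left[of "- monom 1 1" "monom (1::'a) q"]
    by (simp add: P_def degree_monom_eq)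
  then have P0: "P \<noteq> 0"
    using q by auto
  have roots: "{x. poly P x = 0} = {x. x ^ q = x}"
    by (simp add: P_def poly_monom)
  obtain A where A: "size A = q" "P = smult (lead_coeff P) (\<Prod>x\<in>#A. [:-x, 1:])"
    using alg_closed_imp_factorization[OF P0] unfolding deg by blast
  have count: "count A x \<le> 1" for x
  proof (rule ccontr)
    assume "\<not> count A x \<le> 1"
    then have "{#x, x#} \<subseteq># A"
      by (simp add: subseteq_mset_def)
    then obtain C where C: "A = {#x, x#} + C"
      using subset_mset.le_iff_add by blast
    \<comment> \<open>A repeated root gives \<open>P\<close> a square factor, so by the product rule
      the root is shared with \<open>pderiv P\<close>, which is the constant -1.\<close>
    have "P = smult (lead_coeff P) ([:-x, 1:] * ([:-x, 1:] * (\<Prod>x\<in>#C. [:-x, 1:])))"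
      by (subst A(2)) (simp add: C)
    then obtain c r where "P = smult c ([:-x, 1:] * ([:-x, 1:] * r))"
      by blast
    then have "poly (pderiv P) x = 0"
      by (simp only: pderiv_smult pderiv_mult poly_smult poly_add poly_mult) simp
    then show False
      by (simp add: P')
  qed
  \<comment> \<open>Without repetitions \<open>A\<close> is the multiset of its own elements, so its
    size \<open>q\<close> counts distinct roots.\<close>
  have "count A x = count (mset_set (set_mset A)) x" for x
  proof (cases "x \<in># A")
    case True
    then have "count A x = 1"
      using count[of x] by (metis count_greater_eq_one_iff le_antisym)
    with True show ?thesis
      by simp
  qed (simp add: not_in_iff)
  then have "mset_set (set_mset A) = A"
    by (intro multiset_eqI) simp
  then have "card (set_mset A) = q"
    using A(1) size_mset_set[of "set_mset A"] by simp
  moreover have "{x. poly P x = 0} = set_mset A"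
  proof -
    have "poly P x = 0 \<longleftrightarrow> poly (\<Prod>x\<in>#A. [:-x, 1:]) x = 0" for x
      by (subst A(2)) (use P0 in simp)
    then show ?thesis
      by (auto simp: poly_prod_mset)
  qed
  ultimately show ?thesis
    using roots by simp
qed

lemma CHAR_bit: "CHAR(bit) = 2"
proof (rule CHAR_eqI)
  show "2 dvd n" if "of_nat n = (0 :: bit)" for n
    using that even_of_nat[where 'a = bit, of n] by simp
qed simp

lemma CARD_bit: "CARD(bit) = 2"
proof -
  have U: "(UNIV :: bit set) = {0, 1}"
    using Z2.bit_not_one_iff by auto
  show ?thesis
    unfolding U by simp
qed

text \<open>The algebraic closure is viewed as a space over GF(2), so that the finite field found
  inside it can be matched linearly with \<open>V\<close>.\<close>

lemma alg_closure_vector_space: "vector_space (\<lambda>c x. to_ac c * x)"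
  by unfold_locales (simp_all add: distrib_left distrib_right mult.assoc)

theorem theorem7:
  fixes p t1 m :: nat
    and S1 :: "(bit ^ 'n::finite) set"
    and t :: "nat \<Rightarrow> nat"
  assumes "CARD('n) = p"
    and "0 < p" and "0 < t1"
    and "real p / 2 < real t1" and "t1 < p"
    and "projective_subspace (int t1 - 1) S1"
    and "m = 2 ^ t1 + 1"
    and "\<forall>i\<in>{2..m}. 1 \<le> t i \<and> t i \<le> p - t1"
  shows "\<exists>S :: nat \<Rightarrow> (bit ^ 'n) set.
           S 1 = S1
         \<and> (\<forall>i\<in>{2..m}. projective_subspace (int (t i) - 1) (S i) \<and> card (S i) = 2 ^ t i - 1)
         \<and> (\<forall>i\<in>{1..m}. \<forall>j\<in>{1..m}. i \<noteq> j \<longrightarrow> S i \<inter> S j = {})"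
proof -
  interpret ac: vector_space "\<lambda>c (x :: bit alg_closure). to_ac c * x"
    by (rule alg_closure_vector_space)
  interpret va: vector_space_pair "(*s) :: bit \<Rightarrow> bit ^ 'n \<Rightarrow> bit ^ 'n"
      "\<lambda>c (x :: bit alg_closure). to_ac c * x" ..
  interpret av: vector_space_pair "\<lambda>c (x :: bit alg_closure). to_ac c * x"
      "(*s) :: bit \<Rightarrow> bit ^ 'n \<Rightarrow> bit ^ 'n" ..

  \<comment> \<open>The field of order \<open>2 ^ t1\<close>\<close>
  define q :: nat where "q = 2 ^ t1"
  \<comment> \<open>The fixed points of the \<open>t1\<close>-th power of Frobenius; closure under
    addition is the freshman's dream.\<close>
  define K where "K = {x :: bit alg_closure. x ^ q = x}"
  have "prime CHAR(bit alg_closure)" and q_CHAR: "q = CHAR(bit alg_closure) ^ t1"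
    by (simp_all add: CHAR_bit q_def)
  note frob = freshmans_dream'[OF this]
  have cardK: "card K = q"
    unfolding K_def q_CHAR by (rule card_Frobenius_fixed_points) (simp_all add: CHAR_bit assms(3))
  have q0: "q > 0"
    by (simp add: q_def)
  then have finK: "finite K"
    using cardK card_gt_0_iff by metis
  have K_mult: "x * y \<in> K" if "x \<in> K" "y \<in> K" for x y
    using that by (simp add: K_def power_mult_distrib)
  have subK: "ac.subspace K"
  proof (rule ac.subspaceI)
    show "0 \<in> K"
      using q0 by (simp add: K_def)
    show "x + y \<in> K" if "x \<in> K" "y \<in> K" for x y
      using that by (simp add: K_def frob)
    show "to_ac c * x \<in> K" if "x \<in> K" for c x
      using that q0 by (cases c) (simp_all add: K_def)
  qed
  obtain C where C: "C \<subseteq> K" "ac.independent C" "K \<subseteq> ac.span C" "card C = ac.dim K"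
    using ac.basis_exists by blast
  have spanC: "ac.span C = K"
    using C ac.span_subspace subK by blast
  have finC: "finite C"
    using C(1) finK finite_subset by blast
  \<comment> \<open>The dimension of \<open>K\<close> over GF(2) is read off by counting its
    elements in two ways.\<close>
  have "2 ^ card C = (2 ^ t1 :: nat)"
    using ac.card_span_independent[OF finC C(2)] spanC cardK by (simp add: CARD_bit q_def)
  then have cardC: "card C = t1"
    by simp

  \<comment> \<open>A complement of \<open>V\<close> and the projection onto it\<close>
  obtain V where V: "vec.subspace V" "vec.dim V = t1" "S1 = V - {0}"
    using assms(6) by (auto simp: projective_subspace_def)
  obtain B1 where B1: "B1 \<subseteq> V" "vec.independent B1" "V \<subseteq> vec.span B1" "card B1 = t1"
    using vec.basis_exists[of V] V(2) by metis
  have spanB1: "vec.span B1 = V"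
    using B1 V(1) vec.span_subspace by blast
  obtain B where B: "B1 \<subseteq> B" "vec.independent B" "UNIV \<subseteq> vec.span B"
    using vec.maximal_independent_subset_extend[OF subset_UNIV B1(2)] by metis
  have finB: "finite B"
    using B(2) by (rule vec.finiteI_independent)
  have cardB: "card B = p"
    using vec.basis_card_eq_dim[OF subset_UNIV B(3,2)] assms(1) by (simp add: card_cart_basis)
  \<comment> \<open>The complement W is the span of \<open>B2\<close>.\<close>
  define B2 where "B2 = B - B1"
  have finB2: "finite B2" and indB2: "vec.independent B2"
    using finB vec.independent_mono[OF B(2)] by (auto simp: B2_def)
  have cardB2: "card B2 = p - t1"
    using B(1) B1(4) cardB finB by (simp add: B2_def card_Diff_subset finite_subset)

  \<comment> \<open>The projection onto W along \<open>V\<close>; it will recover \<open>w\<close>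
    from the point of any graph lying over \<open>w\<close>.\<close>
  obtain \<pi> :: "bit ^ 'n \<Rightarrow> bit ^ 'n" where lin\<pi>: "Vector_Spaces.linear (*s) (*s) \<pi>"
      and \<pi>: "\<forall>x\<in>B. \<pi> x = (if x \<in> B1 then 0 else x)"
    using vec.linear_independent_extend[OF B(2), of "\<lambda>x. if x \<in> B1 then 0 else x"] by blast
  interpret \<pi>: Vector_Spaces.linear "(*s)" "(*s)" \<pi>
    by (rule lin\<pi>)
  have \<pi>V: "\<pi> x = 0" if "x \<in> V" for x
  proof (rule \<pi>.eq_0_on_span)
    show "x \<in> vec.span B1"
      using that spanB1 by simp
    show "\<pi> b = 0" if "b \<in> B1" for b
      using that \<pi> B(1) by auto
  qed
  have \<pi>W: "\<pi> x = x" if "x \<in> vec.span B2" for x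
    using vec.linear_eq_on[OF lin\<pi> vec.linear_ident that] \<pi> by (auto simp: B2_def)

  \<comment> \<open>The linear maps \<open>g\<close> and \<open>h\<close>\<close>
  have "ac.dim K = vec.dim V"
    using V(2) C(4) cardC by simp
  then obtain g where g: "Vector_Spaces.linear (\<lambda>c x. to_ac c * x) (*s) g" "g ` K = V" "inj_on g K"
    using av.finite_basis_to_basis_subspace_isomorphism[OF subK V(1) _ finC C
        vec.finiteI_independent[OF B1(2)] B1(1,2,3)] B1(4) V(2) by metis

  \<comment> \<open>This is where p/2 < t1 enters: W is small enough to embed into
    \<open>K\<close>.\<close>
  have "p - t1 \<le> card C"
    using assms(4) cardC by linarith
  then obtain C2 where C2: "C2 \<subseteq> C" "card C2 = p - t1" "finite C2"
    by (rule obtain_subset_with_card_n)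
  have indC2: "ac.independent C2"
    using C(2) C2(1) ac.independent_mono by blast
  obtain h where h: "Vector_Spaces.linear (*s) (\<lambda>c x. to_ac c * x) h"
      "h ` vec.span B2 = ac.span C2" "inj_on h (vec.span B2)"
    using va.finite_basis_to_basis_subspace_isomorphism[of "vec.span B2" "ac.span C2" B2 C2]
      cardB2 C2 finB2 indB2 indC2
    by (auto simp: vec.span_superset ac.span_superset
        vec.dim_eq_card_independent ac.dim_eq_card_independent)
  interpret g: Vector_Spaces.linear "\<lambda>c (x :: bit alg_closure). to_ac c * x" "(*s)" g
    by (rule g(1))
  interpret h: Vector_Spaces.linear "(*s)" "\<lambda>c (x :: bit alg_closure). to_ac c * x" h
    by (rule h(1))
  have hK: "h w \<in> K" if "w \<in> vec.span B2" for w
    using that h(2) ac.span_mono[OF C2(1)] spanC by blast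

  \<comment> \<open>The graphs over W\<close>
  define f where "f a w = w + g (a * h w)" for a w
  have linf: "Vector_Spaces.linear (*s) (*s) (f a)" for a
  proof -
    have "f a (x + y) = f a x + f a y" and "f a (c *s x) = c *s f a x" for c x y
      by (simp_all add: f_def h.add h.scale g.add g.scale vec.scale_right_distrib
          distrib_left mult.left_commute[of a])
    then show ?thesis
      by unfold_locales
  qed
  have \<pi>f: "\<pi> (f a w) = w" if "a \<in> K" "w \<in> vec.span B2" for a w
  proof -
    have "g (a * h w) \<in> V"
      using that hK K_mult g(2) by blast
    then show ?thesis
      using that by (simp add: f_def \<pi>.add \<pi>V \<pi>W)
  qed
  \<comment> \<open>Projecting gives \<open>w = w'\<close>; injectivity of \<open>g\<close> on
    \<open>K\<close> then leaves (a - b) * h w = 0, so \<open>h w = 0\<close> in a field, and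
    \<open>h\<close> is injective on W.\<close>
  have f_inj: "w = 0" if ab: "a \<in> K" "b \<in> K" "a \<noteq> b"
      and w: "w \<in> vec.span B2" "w' \<in> vec.span B2" and eq: "f a w = f b w'" for a b w w'
  proof -
    have "w = w'"
      using \<pi>f ab w eq by metis
    then have "g (a * h w) = g (b * h w)"
      using eq by (simp add: f_def)
    then have "a * h w = b * h w"
      using g(3) ab w hK K_mult by (meson inj_onD)
    then have "h w = h 0"
      using ab(3) by (simp add: h.zero)
    then show ?thesis
      using h(3) w(1) vec.span_zero by (meson inj_onD)
  qed

  \<comment> \<open>Choice of the subspaces and their dimensions\<close>
  have "card {2..m} = card K"
    using assms(7) by (simp add: cardK q_def)
  \<comment> \<open>As m - 1 = \<open>2 ^ t1\<close>, each index other than 1 gets its own slope in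
    \<open>K\<close>.\<close>
  then obtain e where e: "bij_betw e {2..m} K"
    using finite_same_card_bij finK by blast
  have eK: "e i \<in> K" if "i \<in> {2..m}" for i
    using e that bij_betwE by blast
  have "\<exists>D\<subseteq>B2. card D = t i" if "i \<in> {2..m}" for i
    using that assms(8) cardB2 by (metis obtain_subset_with_card_n)
  then obtain D where D: "D i \<subseteq> B2" "card (D i) = t i" if "i \<in> {2..m}" for i
    by metis
  have DB2: "vec.span (D i) \<subseteq> vec.span B2" if "i \<in> {2..m}" for i
    using D(1)[OF that] by (rule vec.span_mono)
  define T where "T i = f (e i) ` vec.span (D i)" for i
  define S where "S i = (if i = 1 then S1 else T i - {0})" for i
  have subT: "vec.subspace (T i)" for i
    unfolding T_def using linf vec.subspace_span by (rule vec.linear_subspace_image)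
  have dimT: "vec.dim (T i) = t i" if i: "i \<in> {2..m}" for i
  proof -
    \<comment> \<open>The projection \<open>\<pi>\<close> is a left inverse of
      \<open>f (e i)\<close> on W.\<close>
    have "inj_on (f (e i)) (vec.span (D i))"
      using \<pi>f[OF eK[OF i]] DB2[OF i] by (metis inj_on_inverseI subsetD)
    then have "vec.dim (T i) = vec.dim (vec.span (D i))"
      unfolding T_def by (intro vec.dim_image_eq linf) (simp add: vec.span_span)
    also have "\<dots> = t i"
      using D[OF i] indB2 vec.independent_mono vec.dim_span_eq_card_independent by metis
    finally show ?thesis .
  qed
  have S_dim: "projective_subspace (int (t i) - 1) (S i) \<and> card (S i) = 2 ^ t i - 1" if i: "i \<in> {2..m}" for i
  proof
    have Si: "S i = T i - {0}"
      using i by (simp add: S_def)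
    show "projective_subspace (int (t i) - 1) (S i)"
      unfolding projective_subspace_def using Si subT[of i] dimT[OF i]
      by (intro exI[of _ "T i"]) simp
    show "card (S i) = 2 ^ t i - 1"
      using vec.card_subspace[OF subT[of i]] vec.subspace_0[OF subT[of i]] dimT[OF i]
      by (simp add: Si CARD_bit)
  qed

  \<comment> \<open>Pairwise disjointness\<close>
  have S1_disj: "S 1 \<inter> S j = {}" if j: "j \<in> {2..m}" for j
  proof -
    have "x = 0" if "x \<in> V" "x \<in> T j" for x
    proof -
      obtain w where w: "w \<in> vec.span (D j)" "x = f (e j) w"
        using \<open>x \<in> T j\<close> by (auto simp: T_def)
      \<comment> \<open>\<open>\<pi>\<close> sends \<open>x\<close> to 0 as a point of
        \<open>V\<close> and to \<open>w\<close> as a point of the graph.\<close>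
      then have "w = 0"
        using \<pi>f[OF eK[OF j]] \<pi>V[OF \<open>x \<in> V\<close>] DB2[OF j] by (metis subsetD)
      then show "x = 0"
        using w(2) by (simp add: f_def h.zero g.zero)
    qed
    then show ?thesis
      using j V(3) by (auto simp: S_def)
  qed
  have S_disj: "S i \<inter> S j = {}" if i: "i \<in> {2..m}" and j: "j \<in> {2..m}" and "i \<noteq> j" for i j
  proof -
    have "e i \<noteq> e j"
      using e that by (metis bij_betw_imp_inj_on inj_onD)
    have "x = 0" if "x \<in> T i" "x \<in> T j" for x
    proof -
      obtain w w' where w: "w \<in> vec.span (D i)" "x = f (e i) w" "w' \<in> vec.span (D j)" "x = f (e j) w'"
        using \<open>x \<in> T i\<close> \<open>x \<in> T j\<close> unfolding T_def by blast
      then have "w = 0"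
        using f_inj[OF eK[OF i] eK[OF j] \<open>e i \<noteq> e j\<close>] DB2[OF i] DB2[OF j] by (metis subsetD)
      then show "x = 0"
        using w(2) by (simp add: f_def h.zero g.zero)
    qed
    then show ?thesis
      using i j by (auto simp: S_def)
  qed
  have "S i \<inter> S j = {}" if "i \<in> {1..m}" "j \<in> {1..m}" "i \<noteq> j" for i j
  proof -
    have "i = 1 \<or> i \<in> {2..m}" "j = 1 \<or> j \<in> {2..m}"
      using that by auto
    then show ?thesis
      using S1_disj S_disj that(3) by blast
  qed
  moreover have "S 1 = S1"
    by (simp add: S_def)
  ultimately show ?thesis
    using S_dim by blast
qed

end
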